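(* Assume that $\xi(\cdot)=\sum_{j=1}^N\delta_{u_j}(\cdot)$ with $\boldsymbol u=(u_1,\dots,u_N)\in\mathbb W_N$, and let $\mathcal M_\xi^u$ be a one-parameter family of maps satisfying (i)--(iii) of the context. Let $1\le N'\le N$. For $t\in\mathcal T$, $t\le T<\infty$ ($T\in\mathcal T$), and a measurable function $F_{N'}$ on $S^{N'}$, $$\sum_{\mathbb J\subset\{1,\dots,N\},\ \sharp\mathbb J=N'}\mathrm E_{\boldsymbol u}\Big[F_{N'}(\boldsymbol V_{\mathbb J}(t))\det_{1\le j,k\le N}\big[\mathcal M_\xi^{u_k}(T,V_j(T))\big]\Big] =\int_{\mathbb W_{N'}}\xi^{\otimes N'}(d\boldsymbol v)\,\mathrm E_{\boldsymbol v}\Big[F_{N'}(V_1(t),\dots,V_{N'}(t))\det_{1\le j,k\le N'}\big[\mathcal M_\xi^{v_k}(T,V_j(T))\big]\Big].$$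
   Context: Time set: $\mathcal T=[0,\infty)$ or $\mathcal T=\mathbb N_0=\{0,1,2,\dots\}$. $V(t)$, $t\in\mathcal T$, is a Markov process with state space $S\subset\mathbb R$, with filtration $\mathcal F(t)=\sigma(V(s): s\in[0,t]\cap\mathcal T)$. $N\in\mathbb N$. For $n\in\mathbb N$, $\mathbb W_n=\{\boldsymbol x\in S^n: x_1<\dots<x_n\}$. For $\boldsymbol v=(v_1,\dots,v_n)\in S^n$, under $\mathrm P_{\boldsymbol v}$ (expectation $\mathrm E_{\boldsymbol v}$) the processes $V_1(\cdot),\dots,V_n(\cdot)$ are independent copies of $V(\cdot)$ with $V_j(0)=v_j$. For $\mathbb J=\{j_1<\dots<j_{N'}\}$ put $\boldsymbol V_{\mathbb J}=(V_{j_1},\dots,V_{j_{N'}})$; $\sharp\mathbb J$ is the cardinality of $\mathbb J$. A process $M(t)$, $t\in\mathcal T$, adapted to $\{\mathcal F(t)\}$ is a martingale if $\mathrm E[M(t)|\mathcal F(s)]=M(s)$ a.s. for all $s<t$ in $\mathcal T$; it is a local martingale if there is a nondecreasing sequence of stopping times $T_n$ of $\{\mathcal F(t)\}$ with $\lim_{n\to\infty}T_n=\infty$ almost surely such that $M(t\wedge T_n)$, $t\in\mathcal T$, is a martingale for every $n\in\mathbb N$. Given $\xi=\sum_{j=1}^N\delta_{u_j}$ with $\boldsymbol u\in\mathbb W_N$, it is assumed that there is a one-parameter family of maps $\mathcal M_\xi^u(\cdot,\cdot):\mathcal T\times\mathbb R\to\mathbb R$, with parameter $u\in\mathbb C$,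 such that (i) $\mathcal M_\xi^u(\cdot,V(\cdot))$ is a local martingale; (ii) $\mathcal M_\xi^{u_k}(\cdot,x)$, $1\le k\le N$, are linearly independent functions of $x$; (iii) $\mathcal M_\xi^{u_k}(0,u_j)=\delta_{jk}$ for $u_j,u_k\in\operatorname{supp}\xi=\{u_1,\dots,u_N\}$.
   Formalization: For the time set [0,∞) the processes M^{u_k}(·,V(·)) are assumed to be true martingales under P_{u_j} (false for strict local martingales, e.g. 3-d Bessel with 1/x); the expectations on the left-hand side are assumed to exist. *)

theory Defs
  imports
    "HOL-Probability.Conditional_Expectation"
    "HOL-Probability.Stopping_Time"
    "HOL-Probability.Giry_Monad"
    "Jordan_Normal_Form.Determinant"
begin

(* HOL-Analysis also has a constant det, for matrices with type-indexed dimensions. *)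
hide_const (open) Determinants.det

section \<open>The process and its natural filtration\<close>

text \<open>
  The time set is a set of reals, either \<open>{0..}\<close> or \<open>\<nat>\<close>. The filtration is indexed by
  \<open>ereal\<close> because stopping times may take the value \<open>\<infinity>\<close>, so that the library predicate
  \<^const>\<open>stopping_time\<close> applies.
\<close>

definition nat_filtration ::
  "real set \<Rightarrow> 'w measure \<Rightarrow> (real \<Rightarrow> 'w \<Rightarrow> real) \<Rightarrow> ereal \<Rightarrow> 'w measure" where
  "nat_filtration TT Om V t =
     sigma (space Om) {V s -` A \<inter> space Om | s A. s \<in> TT \<and> ereal s \<le> t \<and> A \<in> sets borel}"

text \<open>
  A Markov process with state space \<open>S\<close> is a process \<open>V\<close> on a measurable space \<open>Om\<close> together
  with a law \<open>P x\<close> for every starting point \<open>x \<in> S\<close>. All laws share the same transition kernels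
  \<open>K s t\<close>, which need not be homogeneous in time.
\<close>

definition markov_process ::
  "real set \<Rightarrow> real set \<Rightarrow> 'w measure \<Rightarrow> (real \<Rightarrow> 'w measure) \<Rightarrow> (real \<Rightarrow> 'w \<Rightarrow> real) \<Rightarrow> bool" where
  "markov_process TT S Om P V \<longleftrightarrow>
     (\<forall>t\<in>TT. V t \<in> Om \<rightarrow>\<^sub>M restrict_space borel S) \<and>
     (\<forall>x\<in>S. prob_space (P x) \<and> sets (P x) = sets Om \<and> (AE w in P x. V 0 w = x)) \<and>
     (\<exists>K :: real \<Rightarrow> real \<Rightarrow> real \<Rightarrow> real measure.
        \<forall>s\<in>TT. \<forall>t\<in>TT. s \<le> t \<longrightarrow>
          K s t \<in> restrict_space borel S \<rightarrow>\<^sub>M prob_algebra (restrict_space borel S) \<and>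
          (\<forall>x\<in>S. \<forall>A\<in>sets (restrict_space borel S). AE w in P x.
             real_cond_exp (P x) (nat_filtration TT Om V (ereal s))
               (indicator (V t -` A \<inter> space Om)) w = measure (K s t (V s w)) A))"

section \<open>Martingales and local martingales\<close>

definition martingale ::
  "real set \<Rightarrow> (ereal \<Rightarrow> 'w measure) \<Rightarrow> 'w measure \<Rightarrow> (real \<Rightarrow> 'w \<Rightarrow> real) \<Rightarrow> bool" where
  "martingale TT F Q X \<longleftrightarrow>
     (\<forall>t\<in>TT. X t \<in> borel_measurable (F (ereal t)) \<and> integrable Q (X t)) \<and>
     (\<forall>s\<in>TT. \<forall>t\<in>TT. s < t \<longrightarrow>
        (AE w in Q. real_cond_exp Q (F (ereal s)) (X t) w = X s w))"

definition stopped ::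
  "(real \<Rightarrow> 'w \<Rightarrow> real) \<Rightarrow> ('w \<Rightarrow> ereal) \<Rightarrow> real \<Rightarrow> 'w \<Rightarrow> real" where
  "stopped X \<tau> t w = X (real_of_ereal (min (ereal t) (\<tau> w))) w"

definition local_martingale ::
  "real set \<Rightarrow> (ereal \<Rightarrow> 'w measure) \<Rightarrow> 'w measure \<Rightarrow> (real \<Rightarrow> 'w \<Rightarrow> real) \<Rightarrow> bool" where
  "local_martingale TT F Q X \<longleftrightarrow>
     (\<forall>t\<in>TT. X t \<in> borel_measurable (F (ereal t))) \<and>
     (\<exists>\<tau> :: nat \<Rightarrow> 'w \<Rightarrow> ereal.
        (\<forall>n. stopping_time F (\<tau> n)) \<and>
        (\<forall>n. \<forall>w\<in>space Q. \<tau> n w \<in> insert \<infinity> (ereal ` TT) \<and> \<tau> n w \<le> \<tau> (Suc n) w) \<and>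
        (AE w in Q. (\<lambda>n. \<tau> n w) \<longlonglongrightarrow> \<infinity>) \<and>
        (\<forall>n. martingale TT F Q (stopped X (\<tau> n))))"

section \<open>Ordered tuples, the configuration, independent copies\<close>

text \<open>
  An \<open>n\<close>-tuple is an extensional function on \<open>{..<n}\<close>; indices start at 0.
\<close>

definition ordered_tuples :: "real set \<Rightarrow> nat \<Rightarrow> (nat \<Rightarrow> real) set" where
  "ordered_tuples S n = {x \<in> {..<n} \<rightarrow>\<^sub>E S. strict_mono_on {..<n} x}"

text \<open>
  The sum of the unit masses at \<open>u 0, \<dots>, u (N - 1)\<close>, as the image under \<open>u\<close> of the counting
  measure on the indices.
\<close>

definition dirac_sum :: "nat \<Rightarrow> (nat \<Rightarrow> real) \<Rightarrow> real measure" where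
  "dirac_sum N u = distr (count_space {..<N}) borel u"

text \<open>
  The \<open>n\<close>-fold product measure. It is completed so that every function is measurable for it
  (it is a finite sum of unit masses); the Bochner integral of a function that is not measurable
  would be 0 by convention.
\<close>

definition dirac_sum_power :: "nat \<Rightarrow> (nat \<Rightarrow> real) \<Rightarrow> nat \<Rightarrow> (nat \<Rightarrow> real) measure" where
  "dirac_sum_power N u n = completion (\<Pi>\<^sub>M i\<in>{..<n}. dirac_sum N u)"

text \<open>
  The law under which the processes \<open>V\<^sub>j(t) = V t (w j)\<close>, \<open>j < n\<close>, are independent copies of
  \<open>V\<close> started at \<open>v j\<close>.
\<close>

definition copies :: "(real \<Rightarrow> 'w measure) \<Rightarrow> nat \<Rightarrow> (nat \<Rightarrow> real) \<Rightarrow> (nat \<Rightarrow> 'w) measure" where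
  "copies P n v = (\<Pi>\<^sub>M j\<in>{..<n}. P (v j))"

text \<open>
  The subfamily with indices in \<open>J\<close>, listed in increasing order of the index.
\<close>

definition subtuple :: "nat set \<Rightarrow> (nat \<Rightarrow> real) \<Rightarrow> nat \<Rightarrow> real" where
  "subtuple J x = (\<lambda>i\<in>{..<card J}. x (sorted_list_of_set J ! i))"

text \<open>
  The matrix with entries \<open>Mf (v k) t (x j)\<close> in row \<open>j\<close> and column \<open>k\<close>.
\<close>

definition mart_matrix ::
  "(complex \<Rightarrow> real \<Rightarrow> real \<Rightarrow> real) \<Rightarrow> nat \<Rightarrow> (nat \<Rightarrow> real) \<Rightarrow> real \<Rightarrow> (nat \<Rightarrow> real) \<Rightarrow> real mat" where
  "mart_matrix Mf n v t x = mat n n (\<lambda>(j, k). Mf (complex_of_real (v k)) t (x j))"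

end

theory Submission
  imports "HOL-Probability.Infinite_Product_Measure" Defs
begin

text \<open>
  For fixed \<open>J\<close>, integrate out the copies with index \<open>j \<notin> J\<close> one after the other. The determinant is
  linear in row \<open>j\<close>, and a linear combination of the martingales has expectation at time \<open>T\<close> equal
  to its value at time 0 at \<open>u j\<close>; so row \<open>j\<close> may be replaced by a row of the identity matrix and the
  determinant shrinks to the complementary minor. What remains is the determinant over \<open>J\<close>, and
  the ordered tuples charged by the configuration are exactly the subtuples of \<open>u\<close>.

  In discrete time the entries need not be integrable, but a linear combination of local
  martingales whose value at \<open>T\<close> is integrable keeps its expectation up to \<open>T\<close>. By Fubini, the assumed
  integrability of the product gives this for almost all of the linear combinations that occur.
\<close>

section \<open>Expectations of local martingales\<close>

text \<open>On the event that \<open>\<tau> i\<close> exceeds \<open>n\<close>, stopping has no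
  effect at the times \<open>n\<close> and \<open>Suc n\<close>. The event is decided at time
  \<open>n\<close>, so its indicator can be pulled out of the conditional expectation. Multiplying
  the stopped martingale by it yields a one-step martingale identity for \<open>X\<close> itself,
  even where \<open>X (Suc n)\<close> is not integrable.\<close>

lemma local_martingale_localize:
  fixes Fl :: "ereal \<Rightarrow> 'w measure" and n :: nat
  assumes lm: "local_martingale \<nat> Fl Q X" and Q: "prob_space Q"
    and sub: "\<And>r. subalgebra Q (Fl r)"
  shows "\<exists>A :: nat \<Rightarrow> 'w set. (\<forall>i. A i \<in> sets (Fl (ereal n))) \<and>
      (AE w in Q. eventually (\<lambda>i. w \<in> A i) sequentially) \<and>
      (\<forall>i. integrable Q (\<lambda>w. indicator (A i) w * X (Suc n) w)) \<and>
      (\<forall>i. AE w in Q. real_cond_exp Q (Fl (ereal n)) (\<lambda>w. indicator (A i) w * X (Suc n) w) w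
        = indicator (A i) w * X n w)"
proof -
  interpret prob_space Q by fact
  interpret finite_measure_subalgebra Q "Fl (ereal n)"
    by unfold_locales (rule sub)
  obtain \<tau> :: "nat \<Rightarrow> 'w \<Rightarrow> ereal" where
    st: "\<And>i. stopping_time Fl (\<tau> i)" and
    val: "\<And>i w. w \<in> space Q \<Longrightarrow> \<tau> i w \<in> insert \<infinity> (ereal ` \<nat>)" and
    lim: "AE w in Q. (\<lambda>i. \<tau> i w) \<longlonglongrightarrow> \<infinity>" and
    mart: "\<And>i. martingale \<nat> Fl Q (stopped X (\<tau> i))"
    using lm unfolding local_martingale_def by blast
  define A where "A i = {w \<in> space (Fl (ereal n)). ereal n < \<tau> i w}" for i
  have sp: "space (Fl (ereal n)) = space Q"
    using sub by (auto simp: subalgebra_def)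
  have A: "A i \<in> sets (Fl (ereal n))" for i
    unfolding A_def using stopping_timeD2[OF st] by measurable
  have A_Q: "A i \<in> sets Q" for i
    using A sub by (auto simp: subalgebra_def)
  have ev: "AE w in Q. eventually (\<lambda>i. w \<in> A i) sequentially"
    using lim AE_space
  proof eventually_elim
    case (elim w)
    then show ?case
      using order_tendstoD(1)[OF elim(1), of "ereal n"] by (simp add: A_def sp)
  qed
  have stopped_Suc: "stopped X (\<tau> i) (Suc n) w = X (Suc n) w"
    and stopped_n: "stopped X (\<tau> i) n w = X n w" if "w \<in> A i" for i w
  proof -
    from that have w: "w \<in> space Q" "ereal n < \<tau> i w"
      by (auto simp: A_def sp)
    \<comment> \<open>This is where discreteness enters: a value in the naturals or
      \<open>\<infinity>\<close> that exceeds \<open>n\<close> is at least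
      \<open>Suc n\<close>.\<close>
    have "ereal (Suc n) \<le> \<tau> i w"
      using val[OF w(1), of i] w(2) by (auto elim!: Nats_cases)
    then show "stopped X (\<tau> i) (Suc n) w = X (Suc n) w"
      by (simp add: stopped_def min_absorb1)
    show "stopped X (\<tau> i) n w = X n w"
      using w(2) by (simp add: stopped_def min_absorb1)
  qed
  have Nats: "real n \<in> \<nat>" "real (Suc n) \<in> \<nat>" "real n < real (Suc n)"
    by (rule of_nat_in_Nats)+ simp
  have int: "integrable Q (stopped X (\<tau> i) (Suc n))" for i
    using mart[of i] Nats unfolding martingale_def by blast
  have eq: "(\<lambda>w. indicator (A i) w * X (Suc n) w) = (\<lambda>w. indicator (A i) w * stopped X (\<tau> i) (Suc n) w)" for i
    using stopped_Suc by (auto simp: indicator_def fun_eq_iff)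
  have int_A: "integrable Q (\<lambda>w. indicator (A i) w * stopped X (\<tau> i) (Suc n) w)" for i
    using integrable_mult_indicator[OF A_Q int] by simp
  have ce: "AE w in Q. real_cond_exp Q (Fl (ereal n)) (\<lambda>w. indicator (A i) w * X (Suc n) w) w
        = indicator (A i) w * X n w" for i
  proof -
    have "AE w in Q. real_cond_exp Q (Fl (ereal n)) (stopped X (\<tau> i) (Suc n)) w = stopped X (\<tau> i) n w"
      using mart[of i] Nats unfolding martingale_def by blast
    moreover have "AE w in Q. real_cond_exp Q (Fl (ereal n))
        (\<lambda>w. indicator (A i) w * stopped X (\<tau> i) (Suc n) w) w
        = indicator (A i) w * real_cond_exp Q (Fl (ereal n)) (stopped X (\<tau> i) (Suc n)) w"
      using int int_A A by (intro real_cond_exp_mult) auto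
    ultimately show ?thesis
      unfolding eq
    proof eventually_elim
      case (elim w)
      then show ?case using stopped_n[of w i] by (auto simp: indicator_def)
    qed
  qed
  show ?thesis
  proof (intro exI[of _ A] conjI allI)
    show "integrable Q (\<lambda>w. indicator (A i) w * X (Suc n) w)" for i
      unfolding eq by (rule int_A)
  qed (fact A ev ce)+
qed

text \<open>
  The individual \<open>X k (Suc n)\<close> need not be integrable; on the localizing sets they are.
\<close>

lemma local_martingale_sum_step:
  fixes Fl :: "ereal \<Rightarrow> 'w measure" and n :: nat
  assumes K: "finite K" and lm: "\<And>k. k \<in> K \<Longrightarrow> local_martingale \<nat> Fl Q (X k)"
    and Q: "prob_space Q" and sub: "\<And>r. subalgebra Q (Fl r)"
    and int: "integrable Q (\<lambda>w. \<Sum>k\<in>K. c k * X k (Suc n) w)"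
  shows "integrable Q (\<lambda>w. \<Sum>k\<in>K. c k * X k n w)"
    and "(\<integral>w. (\<Sum>k\<in>K. c k * X k (Suc n) w) \<partial>Q) = (\<integral>w. (\<Sum>k\<in>K. c k * X k n w) \<partial>Q)"
proof -
  interpret prob_space Q by fact
  interpret finite_measure_subalgebra Q "Fl (ereal n)"
    by unfold_locales (rule sub)
  let ?E = "real_cond_exp Q (Fl (ereal n))"
  have "\<forall>k\<in>K. \<exists>A :: nat \<Rightarrow> 'w set. (\<forall>i. A i \<in> sets (Fl (ereal n))) \<and>
      (AE w in Q. eventually (\<lambda>i. w \<in> A i) sequentially) \<and>
      (\<forall>i. integrable Q (\<lambda>w. indicator (A i) w * X k (Suc n) w)) \<and>
      (\<forall>i. AE w in Q. ?E (\<lambda>w. indicator (A i) w * X k (Suc n) w) w = indicator (A i) w * X k n w)"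
    using local_martingale_localize[OF lm Q sub, of _ n] by blast
  from bchoice[OF this] obtain A :: "_ \<Rightarrow> nat \<Rightarrow> 'w set" where A_all: "\<forall>k\<in>K.
      (\<forall>i. A k i \<in> sets (Fl (ereal n))) \<and>
      (AE w in Q. eventually (\<lambda>i. w \<in> A k i) sequentially) \<and>
      (\<forall>i. integrable Q (\<lambda>w. indicator (A k i) w * X k (Suc n) w)) \<and>
      (\<forall>i. AE w in Q. ?E (\<lambda>w. indicator (A k i) w * X k (Suc n) w) w = indicator (A k i) w * X k n w)"
    by blast
  have
    A: "\<And>k i. k \<in> K \<Longrightarrow> A k i \<in> sets (Fl (ereal n))" and
    ev: "\<And>k. k \<in> K \<Longrightarrow> AE w in Q. eventually (\<lambda>i. w \<in> A k i) sequentially" and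
    int_A: "\<And>k i. k \<in> K \<Longrightarrow> integrable Q (\<lambda>w. indicator (A k i) w * X k (Suc n) w)" and
    ce_A: "\<And>k i. k \<in> K \<Longrightarrow> AE w in Q.
       ?E (\<lambda>w. indicator (A k i) w * X k (Suc n) w) w = indicator (A k i) w * X k n w"
    using A_all by blast+
  have sp: "space (Fl (ereal n)) = space Q" and sets_sub: "sets (Fl (ereal n)) \<subseteq> sets Q"
    using sub by (auto simp: subalgebra_def)
  \<comment> \<open>A single localizing set for all \<open>k\<close> in \<open>K\<close>. The factor
    \<open>space Q\<close> covers empty \<open>K\<close>, where the intersection would be the whole
    type.\<close>
  define B where "B i = space Q \<inter> (\<Inter>k\<in>K. A k i)" for i
  have B: "B i \<in> sets (Fl (ereal n))" for i
  proof -
    have "B i = {w \<in> space (Fl (ereal n)). \<forall>k\<in>K. w \<in> A k i}"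
      by (auto simp: B_def sp)
    also have "\<dots> \<in> sets (Fl (ereal n))"
      using K A by measurable
    finally show ?thesis .
  qed
  have B_Q: "B i \<in> sets Q" for i
    using B sets_sub by auto
  let ?S = "\<lambda>m w. \<Sum>k\<in>K. c k * X k m w"
  have S_meas: "?S n \<in> borel_measurable (Fl (ereal n))"
    using lm by (intro borel_measurable_sum borel_measurable_times) (auto simp: local_martingale_def)
  \<comment> \<open>The conditional expectation of the sum cut off to \<open>B i\<close> is computed
    twice: term by term, since every cut-off term is integrable, and by pulling the indicator out,
    since the whole sum is integrable. The two results are compared on \<open>B i\<close>.\<close>
  have ce_B: "AE w in Q. w \<in> B i \<longrightarrow> ?E (?S (Suc n)) w = ?S n w" for i
  proof -
    have int_B: "integrable Q (\<lambda>w. indicator (B i) w * (indicator (A k i) w * X k (Suc n) w))"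
      if "k \<in> K" for k
      using integrable_mult_indicator[OF B_Q int_A[OF that]] by simp
    have "AE w in Q. ?E (\<lambda>w. indicator (B i) w * (indicator (A k i) w * X k (Suc n) w)) w
        = indicator (B i) w * X k n w" if k: "k \<in> K" for k
    proof -
      have "AE w in Q. ?E (\<lambda>w. indicator (B i) w * (indicator (A k i) w * X k (Suc n) w)) w
        = indicator (B i) w * ?E (\<lambda>w. indicator (A k i) w * X k (Suc n) w) w"
        using B int_A[OF k] int_B[OF k] by (intro real_cond_exp_mult) auto
      with ce_A[OF k, of i] show ?thesis
        by eventually_elim (use k in \<open>auto simp: indicator_def B_def\<close>)
    qed
    moreover have "AE w in Q. ?E (\<lambda>w. c k * (indicator (B i) w * (indicator (A k i) w * X k (Suc n) w))) w
        = c k * ?E (\<lambda>w. indicator (B i) w * (indicator (A k i) w * X k (Suc n) w)) w" if "k \<in> K" for k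
      using int_B[OF that] by (rule real_cond_exp_cmult)
    ultimately have "AE w in Q.
        ?E (\<lambda>w. c k * (indicator (B i) w * (indicator (A k i) w * X k (Suc n) w))) w
        = c k * (indicator (B i) w * X k n w)" if "k \<in> K" for k
      using that by fastforce
    then have ce_k: "AE w in Q. \<forall>k\<in>K.
        ?E (\<lambda>w. c k * (indicator (B i) w * (indicator (A k i) w * X k (Suc n) w))) w
        = c k * (indicator (B i) w * X k n w)"
      using K by (simp add: AE_finite_all)
    \<comment> \<open>\<open>real_cond_exp_sum\<close> asks for integrability at every index, hence
      the default 0 outside \<open>K\<close>.\<close>
    let ?g = "\<lambda>k w. if k \<in> K then c k * (indicator (B i) w * (indicator (A k i) w * X k (Suc n) w)) else 0"
    have int_g: "integrable Q (?g k)" for k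
      using int_B[of k] by (cases "k \<in> K") auto
    have "AE w in Q. ?E (\<lambda>w. \<Sum>k\<in>K. ?g k w) w = (\<Sum>k\<in>K. ?E (?g k) w)"
      by (rule real_cond_exp_sum[OF int_g])
    moreover have "(\<lambda>w. \<Sum>k\<in>K. ?g k w) = (\<lambda>w. indicator (B i) w * ?S (Suc n) w)"
      by (auto simp: fun_eq_iff sum_distrib_left indicator_def B_def intro!: sum.cong)
    moreover have "AE w in Q. ?E (\<lambda>w. indicator (B i) w * ?S (Suc n) w) w = indicator (B i) w * ?E (?S (Suc n)) w"
      using B int integrable_mult_indicator[OF B_Q int] by (intro real_cond_exp_mult) auto
    ultimately have "AE w in Q. indicator (B i) w * ?E (?S (Suc n)) w = (\<Sum>k\<in>K. ?E (?g k) w)"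
      by auto
    with ce_k show ?thesis
    proof eventually_elim
      case (elim w)
      show ?case
      proof
        assume w: "w \<in> B i"
        have "(\<Sum>k\<in>K. ?E (?g k) w) = (\<Sum>k\<in>K. c k * X k n w)"
          using elim(1) w by (intro sum.cong) (auto simp: indicator_def)
        with elim(2) w show "?E (?S (Suc n)) w = ?S n w" by simp
      qed
    qed
  qed
  have "AE w in Q. \<forall>i. w \<in> B i \<longrightarrow> ?E (?S (Suc n)) w = ?S n w"
    by (intro AE_all_countable[THEN iffD2] allI ce_B)
  moreover have "AE w in Q. \<forall>k\<in>K. eventually (\<lambda>i. w \<in> A k i) sequentially"
    using K ev by (simp add: AE_finite_all)
  ultimately have ce: "AE w in Q. ?E (?S (Suc n)) w = ?S n w"
    using AE_space
  proof eventually_elim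
    case (elim w)
    have "eventually (\<lambda>i. \<forall>k\<in>K. w \<in> A k i) sequentially"
      using K elim(2) by (simp add: eventually_ball_finite)
    then obtain i where "\<forall>k\<in>K. w \<in> A k i"
      by (auto simp: eventually_sequentially)
    with elim show ?case by (auto simp: B_def)
  qed
  have [measurable]: "?S n \<in> borel_measurable Q"
    using S_meas sub by (rule measurable_from_subalg[rotated])
  \<comment> \<open>The earlier sum is integrable because it agrees almost everywhere with the
    conditional expectation of an integrable function.\<close>
  show "integrable Q (?S n)"
    using real_cond_exp_int(1)[OF int] ce by (subst integrable_cong_AE[symmetric]) auto
  show "integral\<^sup>L Q (?S (Suc n)) = integral\<^sup>L Q (?S n)"
    using real_cond_exp_int(2)[OF int] ce by (subst integral_cong_AE[of "?S n" Q "?E (?S (Suc n))"]) auto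
qed

text \<open>Integrability is assumed at time \<open>n\<close> only. Each step back in time supplies
  the integrability that the next step back requires.\<close>

lemma local_martingale_sum_expectation:
  fixes Fl :: "ereal \<Rightarrow> 'w measure" and n :: nat
  assumes K: "finite K" and lm: "\<And>k. k \<in> K \<Longrightarrow> local_martingale \<nat> Fl Q (X k)"
    and Q: "prob_space Q" and sub: "\<And>r. subalgebra Q (Fl r)"
    and int: "integrable Q (\<lambda>w. \<Sum>k\<in>K. c k * X k n w)"
  shows "(\<integral>w. (\<Sum>k\<in>K. c k * X k n w) \<partial>Q) = (\<integral>w. (\<Sum>k\<in>K. c k * X k 0 w) \<partial>Q)"
  using int
proof (induction n)
  case (Suc n)
  with local_martingale_sum_step[OF K lm Q sub Suc.prems] show ?case by simp
qed simp

lemma martingale_expectation: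
  assumes M: "martingale TT Fl Q X" and Q: "prob_space Q" and sub: "\<And>r. subalgebra Q (Fl r)"
    and st: "s \<in> TT" "t \<in> TT" "s \<le> t"
  shows "integral\<^sup>L Q (X t) = integral\<^sup>L Q (X s)"
proof (cases "s = t")
  case False
  interpret prob_space Q by fact
  interpret finite_measure_subalgebra Q "Fl (ereal s)"
    by unfold_locales (rule sub)
  have "AE w in Q. real_cond_exp Q (Fl (ereal s)) (X t) w = X s w"
    and int: "integrable Q (X t)" "integrable Q (X s)"
    using M st False by (auto simp: martingale_def)
  then show ?thesis
    using real_cond_exp_int(2)[OF int(1)]
    by (subst integral_cong_AE[of "X s" Q "real_cond_exp Q (Fl (ereal s)) (X t)"]) auto
qed simp

lemma subalgebra_nat_filtration:
  assumes V: "\<And>s. s \<in> TT \<Longrightarrow> V s \<in> borel_measurable Om" and "sets Q = sets Om"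
  shows "subalgebra Q (nat_filtration TT Om V r)"
proof -
  have "{V s -` A \<inter> space Om | s A. s \<in> TT \<and> ereal s \<le> r \<and> A \<in> sets borel} \<subseteq> sets Om"
    using V by (auto intro: measurable_sets)
  moreover have "space Q = space Om"
    using assms(2) by (rule sets_eq_imp_space_eq)
  moreover have "{V s -` A \<inter> space Om | s A. s \<in> TT \<and> ereal s \<le> r \<and> A \<in> sets borel} \<subseteq> Pow (space Om)"
    by auto
  ultimately show ?thesis
    unfolding subalgebra_def nat_filtration_def using assms(2) sets.sigma_sets_subset
    by (simp add: space_measure_of sets_measure_of)
qed

section \<open>Integrating out rows of a determinant\<close>

text \<open>The Leibniz formula over an arbitrary index set, so that deleting a row and its column
  needs no renumbering.\<close>

definition set_det :: "'i set \<Rightarrow> ('i \<Rightarrow> 'i \<Rightarrow> real) \<Rightarrow> real" where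
  "set_det I a = (\<Sum>p | p permutes I. of_int (sign p) * (\<Prod>i\<in>I. a i (p i)))"

text \<open>Laplace expansion along row \<open>j\<close>. The coefficients are obtained before
  \<open>r\<close> is chosen, so the same ones serve every value of that row. The coefficient at
  \<open>j\<close> is the principal minor because permutations of \<open>insert j I\<close> that fix
  \<open>j\<close> are the permutations of \<open>I\<close>.\<close>

lemma set_det_insert_expansion:
  assumes I: "finite I" "j \<notin> I"
  obtains C where "C j = set_det I a"
    and "\<And>r. set_det (insert j I) (a(j := r)) = (\<Sum>k\<in>insert j I. r k * C k)"
proof -
  \<comment> \<open>The signed cofactor of the entry in row \<open>j\<close> and column
    \<open>k\<close>. The product runs over \<open>I\<close> only, so row \<open>j\<close> does not
    occur in it.\<close>
  define C where "C k = (\<Sum>p | p permutes insert j I \<and> p j = k.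
    of_int (sign p) * (\<Prod>i\<in>I. a i (p i)))" for k
  have fin: "finite {p. p permutes insert j I}"
    using I by (simp add: finite_permutations)
  have "{p. p permutes insert j I \<and> p j = j} = {p. p permutes I}"
    using I by (auto simp: permutes_def)
  then have "C j = set_det I a"
    by (simp add: C_def set_det_def)
  moreover have "set_det (insert j I) (a(j := r)) = (\<Sum>k\<in>insert j I. r k * C k)" for r
  proof -
    have "set_det (insert j I) (a(j := r)) = (\<Sum>p | p permutes insert j I.
        r (p j) * (of_int (sign p) * (\<Prod>i\<in>I. a i (p i))))"
      unfolding set_det_def
    proof (intro sum.cong refl)
      fix p
      have "(\<Prod>i\<in>I. (a(j := r)) i (p i)) = (\<Prod>i\<in>I. a i (p i))"
        using I by (intro prod.cong) auto
      then show "of_int (sign p) * (\<Prod>i\<in>insert j I. (a(j := r)) i (p i)) =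
        r (p j) * (of_int (sign p) * (\<Prod>i\<in>I. a i (p i)))"
        using I by simp
    qed
    also have "\<dots> = (\<Sum>k\<in>insert j I. \<Sum>p | p \<in> {p. p permutes insert j I} \<and> p j = k.
        r (p j) * (of_int (sign p) * (\<Prod>i\<in>I. a i (p i))))"
      using I fin permutes_in_image[of _ "insert j I" j] by (intro sum.group[symmetric]) auto
    also have "\<dots> = (\<Sum>k\<in>insert j I. r k * C k)"
      by (auto simp: C_def sum_distrib_left intro!: sum.cong)
    finally show ?thesis .
  qed
  ultimately show ?thesis by (rule that)
qed

text \<open>Conjugation by \<open>e\<close> carries permutations of the positions to permutations of
  \<open>J\<close> and preserves the sign. Rows and columns are renumbered together, so the choice
  of enumeration does not matter.\<close>

lemma det_mat_eq_set_det:
  assumes e: "bij_betw e {..<n} J"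
  shows "det (mat n n (\<lambda>(i, k). a (e i) (e k))) = set_det J a"
proof -
  let ?A = "mat n n (\<lambda>(i, k). a (e i) (e k))"
  have inj: "inj_on e {..<n}"
    using e by (simp add: bij_betw_def)
  have bij: "bij_betw (map_permutation {..<n} e) {p. p permutes {..<n}} {p. p permutes J}"
    using bij_betw_permutations[OF e]
    by (rule bij_betw_cong[THEN iffD1, rotated])
      (use e in \<open>auto simp: map_permutation_def restrict_id_def bij_betw_def fun_eq_iff\<close>)
  have "det ?A = (\<Sum>p | p permutes {..<n}. of_int (sign p) * (\<Prod>i<n. a (e i) (e (p i))))"
    by (subst det_def'[of _ n]) (auto simp: atLeast0LessThan permutes_in_image intro!: sum.cong prod.cong)
  also have "\<dots> = (\<Sum>p | p permutes {..<n}. of_int (sign (map_permutation {..<n} e p)) *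
      (\<Prod>i\<in>J. a i (map_permutation {..<n} e p i)))"
  proof (intro sum.cong refl)
    fix p assume "p \<in> {p. p permutes {..<n}}"
    moreover have "(\<Prod>i\<in>J. a i (map_permutation {..<n} e p i)) = (\<Prod>i<n. a (e i) (e (p i)))"
      using map_permutation_apply[OF inj]
      by (intro prod.reindex_bij_betw[OF e, symmetric, THEN trans]) auto
    ultimately show "of_int (sign p) * (\<Prod>i<n. a (e i) (e (p i))) =
      of_int (sign (map_permutation {..<n} e p)) * (\<Prod>i\<in>J. a i (map_permutation {..<n} e p i))"
      using inj by (simp add: sign_map_permutation)
  qed
  also have "\<dots> = set_det J a"
    unfolding set_det_def by (rule sum.reindex_bij_betw[OF bij])
  finally show ?thesis .
qed

lemma borel_measurable_set_det [measurable]: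
  assumes "finite I" "\<And>i k. i \<in> I \<Longrightarrow> (\<lambda>x. a x i k) \<in> borel_measurable M"
  shows "(\<lambda>x. set_det I (a x)) \<in> borel_measurable M"
  unfolding set_det_def using assms
  by (intro borel_measurable_sum borel_measurable_times borel_measurable_prod) auto

text \<open>
  Integrability of the product forces integrability in \<open>y\<close> of the relevant linear combination of
  the columns, so the columns themselves need not be integrable.
\<close>

lemma integral_set_det_insert:
  fixes Q :: "'i \<Rightarrow> 'w measure" and m :: "'i \<Rightarrow> 'w \<Rightarrow> real" and G :: "('i \<Rightarrow> 'w) \<Rightarrow> real"
  assumes I: "finite I" "j \<notin> I"
    and Q: "\<And>i. i \<in> insert j I \<Longrightarrow> prob_space (Q i)"
    and m: "\<And>i k. i \<in> I \<Longrightarrow> m k \<in> borel_measurable (Q i)"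
    and row: "\<And>c. integrable (Q j) (\<lambda>y. \<Sum>k\<in>insert j I. c k * m k y) \<Longrightarrow>
      (\<integral>y. (\<Sum>k\<in>insert j I. c k * m k y) \<partial>Q j) = c j"
    and G: "\<And>x y. G (x(j := y)) = G x" and G_meas: "G \<in> borel_measurable (Pi\<^sub>M I Q)"
    and int: "integrable (Pi\<^sub>M (insert j I) Q) (\<lambda>x. G x * set_det (insert j I) (\<lambda>i k. m k (x i)))"
  shows "integrable (Pi\<^sub>M I Q) (\<lambda>x. G x * set_det I (\<lambda>i k. m k (x i)))"
    and "(\<integral>x. G x * set_det (insert j I) (\<lambda>i k. m k (x i)) \<partial>Pi\<^sub>M (insert j I) Q) =
      (\<integral>x. G x * set_det I (\<lambda>i k. m k (x i)) \<partial>Pi\<^sub>M I Q)"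
proof -
  let ?f = "\<lambda>x. G x * set_det (insert j I) (\<lambda>i k. m k (x i))"
  let ?g = "\<lambda>x. G x * set_det I (\<lambda>i k. m k (x i))"
  interpret Qj: prob_space "Q j" using Q by simp
  interpret QI: prob_space "Pi\<^sub>M I Q" using Q by (intro prob_space_PiM) simp
  interpret pair_sigma_finite "Q j" "Pi\<^sub>M I Q" ..
  have eq: "Pi\<^sub>M (insert j I) Q = distr (Q j \<Otimes>\<^sub>M Pi\<^sub>M I Q) (Pi\<^sub>M (insert j I) Q) (\<lambda>(y, x). x(j := y))"
    using I Q by (intro distr_pair_PiM_eq_PiM[symmetric]) auto
  have upd: "(\<lambda>(y, x). x(j := y)) \<in> Q j \<Otimes>\<^sub>M Pi\<^sub>M I Q \<rightarrow>\<^sub>M Pi\<^sub>M (insert j I) Q"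
    by measurable
  have f_meas: "?f \<in> borel_measurable (Pi\<^sub>M (insert j I) Q)"
    using int by auto
  have "integrable (distr (Q j \<Otimes>\<^sub>M Pi\<^sub>M I Q) (Pi\<^sub>M (insert j I) Q) (\<lambda>(y, x). x(j := y))) ?f"
    using int eq by simp
  then have int_pair: "integrable (Q j \<Otimes>\<^sub>M Pi\<^sub>M I Q) (\<lambda>(y, x). ?f (x(j := y)))"
    using integrable_distr[OF upd, of ?f] by (simp add: split_def)
  have inner: "(\<integral>y. ?f (x(j := y)) \<partial>Q j) = ?g x" if x: "integrable (Q j) (\<lambda>y. ?f (x(j := y)))" for x
  proof -
    obtain C where Cj: "C j = set_det I (\<lambda>i k. m k (x i))" and
      C: "\<And>r. set_det (insert j I) ((\<lambda>i k. m k (x i))(j := r)) = (\<Sum>k\<in>insert j I. r k * C k)"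
      using set_det_insert_expansion[OF I] by blast
    \<comment> \<open>With \<open>x\<close> fixed, \<open>G x\<close> and the cofactors are
      constants in \<open>y\<close>. The assumption \<open>row\<close> then picks out the
      coefficient of index \<open>j\<close>, which is \<open>G x * C j\<close>.\<close>
    have f_eq: "?f (x(j := y)) = (\<Sum>k\<in>insert j I. (G x * C k) * m k y)" for y
    proof -
      have "(\<lambda>i k. m k ((x(j := y)) i)) = (\<lambda>i k. m k (x i))(j := \<lambda>k. m k y)"
        by (auto simp: fun_eq_iff)
      then show ?thesis
        by (simp only: G C sum_distrib_left) (simp add: mult_ac)
    qed
    show ?thesis
      using x row[of "\<lambda>k. G x * C k"] Cj unfolding f_eq by simp
  qed
  \<comment> \<open>Fubini provides integrable sections for almost every \<open>x\<close> only, and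
    \<open>inner\<close> is available exactly for those.\<close>
  have AE: "AE x in Pi\<^sub>M I Q. (\<integral>y. ?f (x(j := y)) \<partial>Q j) = ?g x"
    using AE_integrable_snd[OF int_pair] by eventually_elim (rule inner)
  have [measurable]: "?g \<in> borel_measurable (Pi\<^sub>M I Q)"
  proof (intro borel_measurable_times borel_measurable_set_det G_meas I(1))
    fix i k assume "i \<in> I"
    then show "(\<lambda>x. m k (x i)) \<in> borel_measurable (Pi\<^sub>M I Q)"
      using m by (intro measurable_compose[OF measurable_component_singleton]) auto
  qed
  have int_snd: "integrable (Pi\<^sub>M I Q) (\<lambda>x. \<integral>y. ?f (x(j := y)) \<partial>Q j)"
    using integrable_snd[OF int_pair] .
  then show "integrable (Pi\<^sub>M I Q) ?g"
    using AE by (subst integrable_cong_AE[symmetric]) auto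
  have "integral\<^sup>L (Pi\<^sub>M (insert j I) Q) ?f = integral\<^sup>L (Q j \<Otimes>\<^sub>M Pi\<^sub>M I Q) (\<lambda>(y, x). ?f (x(j := y)))"
    by (subst eq, subst integral_distr[OF upd f_meas]) (simp add: split_def)
  also have "\<dots> = (\<integral>x. (\<integral>y. ?f (x(j := y)) \<partial>Q j) \<partial>Pi\<^sub>M I Q)"
    using integral_snd[OF int_pair] by simp
  also have "\<dots> = integral\<^sup>L (Pi\<^sub>M I Q) ?g"
    using int_snd AE by (intro integral_cong_AE) auto
  finally show "integral\<^sup>L (Pi\<^sub>M (insert j I) Q) ?f = integral\<^sup>L (Pi\<^sub>M I Q) ?g" .
qed

text \<open>The rows in \<open>D\<close> are removed one at a time. Since the set of columns shrinks
  along the way, \<open>row\<close> is assumed for every index set \<open>K\<close> inside the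
  union.\<close>

lemma integral_set_det_Un:
  fixes Q :: "'i \<Rightarrow> 'w measure" and m :: "'i \<Rightarrow> 'w \<Rightarrow> real" and G :: "('i \<Rightarrow> 'w) \<Rightarrow> real"
  assumes fin: "finite J" "finite D" and disj: "J \<inter> D = {}"
    and Q: "\<And>i. i \<in> J \<union> D \<Longrightarrow> prob_space (Q i)"
    and m: "\<And>i k. i \<in> J \<union> D \<Longrightarrow> m k \<in> borel_measurable (Q i)"
    and row: "\<And>j K c. j \<in> K \<Longrightarrow> K \<subseteq> J \<union> D \<Longrightarrow> integrable (Q j) (\<lambda>y. \<Sum>k\<in>K. c k * m k y) \<Longrightarrow>
      (\<integral>y. (\<Sum>k\<in>K. c k * m k y) \<partial>Q j) = c j"
    and G: "\<And>x. G (restrict x J) = G x" and G_meas: "G \<in> borel_measurable (Pi\<^sub>M J Q)"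
    and int: "integrable (Pi\<^sub>M (J \<union> D) Q) (\<lambda>x. G x * set_det (J \<union> D) (\<lambda>i k. m k (x i)))"
  shows "(\<integral>x. G x * set_det (J \<union> D) (\<lambda>i k. m k (x i)) \<partial>Pi\<^sub>M (J \<union> D) Q) =
      (\<integral>x. G x * set_det J (\<lambda>i k. m k (x i)) \<partial>Pi\<^sub>M J Q)"
  using fin(2) disj Q m row int
proof (induction D rule: finite_induct)
  case (insert d D)
  let ?I = "J \<union> D"
  have Un: "J \<union> insert d D = insert d ?I" by simp
  have d: "d \<notin> ?I" and finI: "finite ?I"
    using insert.hyps insert.prems(1) fin(1) by auto
  have G_upd: "G (x(d := y)) = G x" for x y
  proof -
    have "restrict (x(d := y)) J = restrict x J"
      using d by (auto simp: restrict_def)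
    then show ?thesis using G by metis
  qed
  have "(\<lambda>x. G (restrict x J)) \<in> borel_measurable (Pi\<^sub>M ?I Q)"
    using G_meas by (intro measurable_compose[OF measurable_restrict_subset]) auto
  then have G_I: "G \<in> borel_measurable (Pi\<^sub>M ?I Q)"
    by (simp add: G)
  have *: "integrable (Pi\<^sub>M ?I Q) (\<lambda>x. G x * set_det ?I (\<lambda>i k. m k (x i)))"
    "(\<integral>x. G x * set_det (insert d ?I) (\<lambda>i k. m k (x i)) \<partial>Pi\<^sub>M (insert d ?I) Q) =
      (\<integral>x. G x * set_det ?I (\<lambda>i k. m k (x i)) \<partial>Pi\<^sub>M ?I Q)"
    using insert.prems(2-5)
    by (intro integral_set_det_insert[OF finI d _ _ _ G_upd G_I]; simp)+
  have "(\<integral>x. G x * set_det ?I (\<lambda>i k. m k (x i)) \<partial>Pi\<^sub>M ?I Q) =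
      (\<integral>x. G x * set_det J (\<lambda>i k. m k (x i)) \<partial>Pi\<^sub>M J Q)"
  proof (rule insert.IH)
    show "(\<integral>y. (\<Sum>k\<in>K. c k * m k y) \<partial>Q j) = c j"
      if "j \<in> K" "K \<subseteq> ?I" "integrable (Q j) (\<lambda>y. \<Sum>k\<in>K. c k * m k y)" for j K c
      using that by (intro insert.prems(4)) auto
  qed (use insert.prems *(1) in auto)
  with *(2) show ?case by (simp only: Un)
qed simp

section \<open>Integrals over the configuration\<close>

text \<open>The product measure lives on finitely many tuples of atoms, each of mass 1. Off these
  tuples \<open>f\<close> is arbitrary, and completeness makes it measurable all the same.\<close>

lemma integral_dirac_sum_power:
  fixes f :: "(nat \<Rightarrow> real) \<Rightarrow> real"
  assumes u: "inj_on u {..<N}"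
  shows "integral\<^sup>L (dirac_sum_power N u n) f = (\<Sum>a\<in>{..<n} \<rightarrow>\<^sub>E u ` {..<N}. f a)"
proof -
  define D where "D = dirac_sum N u"
  define M where "M = (\<Pi>\<^sub>M i\<in>{..<n}. D)"
  define A where "A = ({..<n} \<rightarrow>\<^sub>E u ` {..<N})"
  have sets_D: "sets D = sets borel" and space_D: "space D = UNIV"
    by (simp_all add: D_def dirac_sum_def)
  have em_D: "emeasure D B = card {i. i < N \<and> u i \<in> B}" if "B \<in> sets borel" for B
  proof -
    have "u -` B \<inter> {..<N} = {i. i < N \<and> u i \<in> B}" by auto
    then show ?thesis
      using that by (simp add: D_def dirac_sum_def emeasure_distr emeasure_count_space subset_iff)
  qed
  interpret D: finite_measure D
    by (rule finite_measureI) (simp add: em_D space_D)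
  interpret product_sigma_finite "\<lambda>_::nat. D"
    by unfold_locales
  have fin_A: "finite A"
    by (auto simp: A_def intro!: finite_PiE)
  have R: "u ` {..<N} \<in> sets borel"
    by (intro borel_closed finite_imp_closed) simp
  have A: "A \<in> sets M"
    unfolding A_def M_def using R by (intro sets_PiM_I_finite) (auto simp: sets_D)
  have null: "space M - A \<in> null_sets M"
  proof -
    have em: "emeasure D (u ` {..<N}) = emeasure D UNIV"
    proof -
      have "{i. i < N \<and> u i \<in> u ` {..<N}} = {i. i < N \<and> u i \<in> UNIV}" by auto
      then show ?thesis
        using em_D[OF R] em_D[of UNIV] by simp
    qed
    have "emeasure M A = (\<Prod>i<n. emeasure D (u ` {..<N}))"
      unfolding A_def M_def using R by (subst emeasure_PiM) (auto simp: sets_D)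
    also have "\<dots> = (\<Prod>i<n. emeasure D UNIV)"
      by (simp only: em)
    also have "\<dots> = emeasure M (space M)"
      unfolding M_def space_PiM space_D by (subst emeasure_PiM) (auto simp: sets_D)
    finally have eq: "emeasure M A = emeasure M (space M)" .
    have "emeasure M A \<noteq> \<infinity>"
      unfolding A_def M_def using R
      by (subst emeasure_PiM) (auto simp: sets_D em_D power_eq_top_ennreal)
    with A eq have "emeasure M (space M - A) = 0"
      by (subst emeasure_Diff) (auto simp: sets.sets_into_space)
    then show ?thesis
      using A by auto
  qed
  have single: "{a} \<in> sets M" "emeasure M {a} = 1" if a: "a \<in> A" for a
  proof -
    have eq: "{a} = (\<Pi>\<^sub>E i\<in>{..<n}. {a i})"
      using a by (subst PiE_singleton) (auto simp: A_def PiE_def)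
    show "{a} \<in> sets M"
      unfolding eq M_def by (intro sets_PiM_I_finite) (auto simp: sets_D)
    have "emeasure D {a i} = 1" if i: "i < n" for i
    proof -
      obtain k where k: "k < N" "a i = u k"
        using a i by (auto simp: A_def)
      \<comment> \<open>Injectivity of \<open>u\<close> excludes multiplicities, so each atom has
        mass exactly 1.\<close>
      then have "{j. j < N \<and> u j \<in> {a i}} = {k}"
        using u by (auto simp: inj_on_def)
      then show ?thesis by (simp add: em_D)
    qed
    then show "emeasure M {a} = 1"
      unfolding eq M_def by (subst emeasure_PiM) (auto simp: sets_D)
  qed
  let ?C = "completion M"
  \<comment> \<open>A finite combination of indicators that agrees with \<open>f\<close> off a null
    set, and whose integral can be read off.\<close>
  define g where "g x = (\<Sum>a\<in>A. f a * indicator {a} x)" for x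
  have g_eq: "g x = f x" if "x \<in> A" for x
  proof -
    have "g x = (\<Sum>a\<in>A. if a = x then f x else 0)"
      unfolding g_def by (intro sum.cong) (auto simp: indicator_def)
    then show ?thesis using that fin_A by simp
  qed
  have g_meas: "g \<in> borel_measurable ?C"
    unfolding g_def using single(1)
    by (intro borel_measurable_sum borel_measurable_times borel_measurable_indicator
      sets_completionI_sets borel_measurable_const) auto
  have f_meas: "f \<in> borel_measurable ?C"
  proof (rule measurableI)
    fix B :: "real set" assume "B \<in> sets borel"
    have "f -` B \<inter> space ?C = (\<Union>a\<in>A \<inter> f -` B. {a}) \<union> (f -` B \<inter> (space M - A))"
      using sets.sets_into_space[OF A] by auto
    also have "\<dots> \<in> sets ?C"
    proof (rule sets.Un)
      show "(\<Union>a\<in>A \<inter> f -` B. {a}) \<in> sets ?C"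
        using fin_A single(1) by (intro sets.finite_UN sets_completionI_sets) auto
      have "f -` B \<inter> (space M - A) \<in> null_sets ?C"
        by (rule completion.complete2[OF _ null_sets_completionI[OF null]]) auto
      then show "f -` B \<inter> (space M - A) \<in> sets ?C" by auto
    qed
    finally show "f -` B \<inter> space ?C \<in> sets ?C" .
  qed simp
  have "AE x in ?C. f x = g x"
    using AE_not_in[OF null_sets_completionI[OF null]] AE_space
    by eventually_elim (auto simp: g_eq)
  then have "integral\<^sup>L ?C f = integral\<^sup>L ?C g"
    using f_meas g_meas by (intro integral_cong_AE)
  also have "\<dots> = (\<Sum>a\<in>A. \<integral>x. f a * indicator {a} x \<partial>?C)"
    unfolding g_def using single by (intro Bochner_Integration.integral_sum integrable_mult_right) auto
  also have "\<dots> = (\<Sum>a\<in>A. f a)"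
    using single by (intro sum.cong) (auto simp: measure_def)
  finally show ?thesis
    by (simp add: dirac_sum_power_def M_def D_def A_def)
qed

section \<open>Ordered tuples of atoms as subtuples of \<open>u\<close>\<close>

lemma strict_mono_on_lessThan_eqI:
  fixes f g :: "nat \<Rightarrow> 'a :: linorder"
  assumes f: "strict_mono_on {..<n} f" and g: "strict_mono_on {..<n} g"
    and image: "f ` {..<n} = g ` {..<n}" and i: "i < n"
  shows "f i = g i"
proof -
  have "sorted_wrt (<) (map h [0..<n])" if "strict_mono_on {..<n} h" for h :: "nat \<Rightarrow> 'a"
    using that by (auto simp: sorted_wrt_iff_nth_less strict_mono_on_def)
  then have "map f [0..<n] = map g [0..<n]"
    using f g image by (intro strict_sorted_equal) (auto simp: atLeast0LessThan)
  with i show ?thesis by simp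
qed

lemma bij_betw_nth_sorted_list_of_set:
  "finite J \<Longrightarrow> bij_betw (\<lambda>i. sorted_list_of_set J ! i) {..<card J} J"
  by (rule bij_betw_nth) auto

lemma subtuple_ordered:
  assumes u: "u \<in> ordered_tuples S N" and J: "J \<subseteq> {..<N}"
  shows "subtuple J u \<in> ordered_tuples S (card J)" and "subtuple J u ` {..<card J} = u ` J"
proof -
  let ?e = "\<lambda>i. sorted_list_of_set J ! i"
  have fin: "finite J" using J finite_subset by blast
  note bij = bij_betw_nth_sorted_list_of_set[OF fin]
  have e_J: "?e i \<in> J" if "i < card J" for i
    using bij that by (auto simp: bij_betw_def)
  have "?e i < ?e j" if "i < j" "j < card J" for i j
    using that fin strict_sorted_list_of_set[of J] by (intro sorted_wrt_nth_less[of "(<)"]) auto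
  then have "strict_mono_on {..<card J} (subtuple J u)"
    using u J e_J by (auto simp: strict_mono_on_def subtuple_def ordered_tuples_def subset_iff)
  moreover have "subtuple J u \<in> {..<card J} \<rightarrow>\<^sub>E S"
    using u J e_J by (auto simp: subtuple_def ordered_tuples_def)
  ultimately show "subtuple J u \<in> ordered_tuples S (card J)"
    by (simp add: ordered_tuples_def)
  have "subtuple J u ` {..<card J} = u ` (?e ` {..<card J})"
    by (auto simp: subtuple_def image_image)
  then show "subtuple J u ` {..<card J} = u ` J"
    using bij by (simp add: bij_betw_def)
qed

text \<open>An increasing tuple is determined by its set of values. Since \<open>u\<close> is
  injective, such a set of atoms is the same thing as a set of indices.\<close>

lemma bij_betw_subtuple:
  assumes u: "u \<in> ordered_tuples S N"
  shows "bij_betw (\<lambda>J. subtuple J u) {J. J \<subseteq> {..<N} \<and> card J = n}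
    (ordered_tuples S n \<inter> ({..<n} \<rightarrow>\<^sub>E u ` {..<N}))"
proof (rule bij_betw_imageI)
  have inj: "inj_on u {..<N}"
    using u by (auto simp: ordered_tuples_def intro: strict_mono_on_imp_inj_on)
  show "inj_on (\<lambda>J. subtuple J u) {J. J \<subseteq> {..<N} \<and> card J = n}"
  proof (rule inj_onI, clarify)
    fix J J' assume J: "J \<subseteq> {..<N}" "J' \<subseteq> {..<N}" "card J' = card J" "subtuple J u = subtuple J' u"
    then have "u ` J = u ` J'"
      using subtuple_ordered(2)[OF u] by metis
    with inj J(1,2) show "J = J'" by (simp add: inj_on_image_eq_iff)
  qed
  show "(\<lambda>J. subtuple J u) ` {J. J \<subseteq> {..<N} \<and> card J = n} = ordered_tuples S n \<inter> ({..<n} \<rightarrow>\<^sub>E u ` {..<N})"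
  proof (intro equalityI subsetI)
    fix v assume "v \<in> (\<lambda>J. subtuple J u) ` {J. J \<subseteq> {..<N} \<and> card J = n}"
    then obtain J where J: "J \<subseteq> {..<N}" "card J = n" and v: "v = subtuple J u" by auto
    have "v \<in> ordered_tuples S n" "v ` {..<n} = u ` J"
      using subtuple_ordered[OF u J(1)] J(2) v by simp_all
    then show "v \<in> ordered_tuples S n \<inter> ({..<n} \<rightarrow>\<^sub>E u ` {..<N})"
      using image_mono[OF J(1), of u] by (auto simp: ordered_tuples_def PiE_iff)
  next
    fix v assume "v \<in> ordered_tuples S n \<inter> ({..<n} \<rightarrow>\<^sub>E u ` {..<N})"
    then have mono_v: "strict_mono_on {..<n} v" and v_u: "v ` {..<n} \<subseteq> u ` {..<N}"
      and ext_v: "v \<in> extensional {..<n}"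
      by (auto simp: ordered_tuples_def PiE_iff)
    define J where "J = {k. k < N \<and> u k \<in> v ` {..<n}}"
    have J: "J \<subseteq> {..<N}" by (auto simp: J_def)
    have uJ: "u ` J = v ` {..<n}"
    proof (intro equalityI subsetI)
      fix x assume x: "x \<in> v ` {..<n}"
      with v_u obtain k where "k < N" "x = u k" by auto
      with x show "x \<in> u ` J" by (auto simp: J_def)
    qed (auto simp: J_def)
    have "card J = card (u ` J)"
      using inj J by (metis card_image inj_on_subset)
    also have "\<dots> = n"
      using uJ strict_mono_on_imp_inj_on[OF mono_v] by (simp add: card_image)
    finally have card: "card J = n" .
    have sub: "strict_mono_on {..<n} (subtuple J u)" "subtuple J u ` {..<n} = v ` {..<n}"
      "subtuple J u \<in> extensional {..<n}"
      using subtuple_ordered[OF u J] uJ card by (auto simp: ordered_tuples_def PiE_iff)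
    have "subtuple J u = v"
      using strict_mono_on_lessThan_eqI[OF sub(1) mono_v sub(2)] sub(3) ext_v
      by (intro extensionalityI) auto
    with J card show "v \<in> (\<lambda>J. subtuple J u) ` {J. J \<subseteq> {..<N} \<and> card J = n}"
      by auto
  qed
qed

section \<open>The determinantal identity\<close>

text \<open>An integrable local martingale in continuous time can still lose expectation, hence the
  true martingale property in \<open>continuous_time\<close>. The assumption
  \<open>expectations_exist\<close> gives meaning to the expectations on the left, as the Bochner
  integral of a non-integrable function is 0 by convention.\<close>

theorem lemma1p1:
  fixes TT S :: "real set" and Om :: "'w measure"
    and P :: "real \<Rightarrow> 'w measure" and V :: "real \<Rightarrow> 'w \<Rightarrow> real"
    and N N' :: nat and u :: "nat \<Rightarrow> real"
    and Mf :: "complex \<Rightarrow> real \<Rightarrow> real \<Rightarrow> real"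
    and F :: "(nat \<Rightarrow> real) \<Rightarrow> real" and t T :: real
  assumes time_set: "TT = {0..} \<or> TT = \<nat>"
    and markov: "markov_process TT S Om P V"
    and u: "u \<in> ordered_tuples S N"
    and loc_mart: "\<And>z x. x \<in> S \<Longrightarrow>
      local_martingale TT (nat_filtration TT Om V) (P x) (\<lambda>s w. Mf z s (V s w))"
    and lin_indep: "\<And>s c. s \<in> TT \<Longrightarrow>
      (\<And>x. (\<Sum>k<N. c k * Mf (complex_of_real (u k)) s x) = 0) \<Longrightarrow> (\<forall>k<N. c k = (0::real))"
    and initial: "\<And>j k. j < N \<Longrightarrow> k < N \<Longrightarrow>
      Mf (complex_of_real (u k)) 0 (u j) = (if j = k then 1 else 0)"
    and N': "1 \<le> N'" "N' \<le> N"
    and times: "t \<in> TT" "T \<in> TT" "t \<le> T"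
    and F: "F \<in> borel_measurable (\<Pi>\<^sub>M i\<in>{..<N'}. restrict_space borel S)"
    and expectations_exist: "\<And>J. J \<subseteq> {..<N} \<Longrightarrow> card J = N' \<Longrightarrow>
      integrable (copies P N u) (\<lambda>w. F (subtuple J (\<lambda>j. V t (w j))) *
        det (mart_matrix Mf N u T (\<lambda>j. V T (w j))))"
    and continuous_time: "\<And>j k. TT = {0..} \<Longrightarrow> j < N \<Longrightarrow> k < N \<Longrightarrow>
      martingale TT (nat_filtration TT Om V) (P (u j))
        (\<lambda>s w. Mf (complex_of_real (u k)) s (V s w))"
  shows "(\<Sum>J | J \<subseteq> {..<N} \<and> card J = N'.
           \<integral>w. F (subtuple J (\<lambda>j. V t (w j))) *
                det (mart_matrix Mf N u T (\<lambda>j. V T (w j))) \<partial>copies P N u) =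
         (LINT v:ordered_tuples S N' | dirac_sum_power N u N'.
           (\<integral>w. F (\<lambda>j\<in>{..<N'}. V t (w j)) *
                det (mart_matrix Mf N' v T (\<lambda>j. V T (w j))) \<partial>copies P N' v))"
proof -
  define X where "X k s w = Mf (complex_of_real (u k)) s (V s w)" for k s w
  define m where "m k = X k T" for k
  define Fl where "Fl = nat_filtration TT Om V"
  have u_S: "u j \<in> S" if "j < N" for j
    using u that by (auto simp: ordered_tuples_def)
  have inj_u: "inj_on u {..<N}"
    using u by (auto simp: ordered_tuples_def intro: strict_mono_on_imp_inj_on)
  have zero: "0 \<in> TT" and T0: "0 \<le> T"
    using time_set times by (auto elim: Nats_cases)
  have V: "V s \<in> Om \<rightarrow>\<^sub>M restrict_space borel S" if "s \<in> TT" for s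
    using markov that by (auto simp: markov_process_def)
  have V_borel: "V s \<in> borel_measurable Om" if "s \<in> TT" for s
    using V[OF that] by (simp add: measurable_restrict_space2_iff)
  have prob: "prob_space (P x)" and sets_P: "sets (P x) = sets Om" and V0: "AE w in P x. V 0 w = x"
    if "x \<in> S" for x
    using markov that by (auto simp: markov_process_def)
  have sub: "subalgebra (P x) (Fl r)" if "x \<in> S" for x r
    unfolding Fl_def using V_borel sets_P[OF that] by (rule subalgebra_nat_filtration)
  have lm: "local_martingale TT Fl (P x) (X k)" if "x \<in> S" for x k
    unfolding X_def Fl_def using loc_mart[OF that] .
  have X_meas: "X k s \<in> borel_measurable (P x)" if "x \<in> S" "s \<in> TT" for x k s
  proof (rule measurable_from_subalg[OF sub[OF that(1)]])
    show "X k s \<in> borel_measurable (Fl (ereal s))"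
      using lm[OF that(1), of k] that(2) by (simp add: local_martingale_def)
  qed
  \<comment> \<open>The expectation is carried back from \<open>T\<close> to time 0, where the
    process sits at \<open>u j\<close> and \<open>initial\<close> leaves only the term with
    \<open>k = j\<close>.\<close>
  have row: "(\<integral>w. (\<Sum>k\<in>K. c k * m k w) \<partial>P (u j)) = c j"
    if j: "j \<in> K" and K: "K \<subseteq> {..<N}"
      and int: "integrable (P (u j)) (\<lambda>w. \<Sum>k\<in>K. c k * m k w)" for j K c
  proof -
    have jN: "j < N" using j K by auto
    have finK: "finite K" using K finite_subset by blast
    note uj = u_S[OF jN]
    interpret prob_space "P (u j)" using prob[OF uj] .
    have "(\<integral>w. (\<Sum>k\<in>K. c k * X k T w) \<partial>P (u j)) = (\<integral>w. (\<Sum>k\<in>K. c k * X k 0 w) \<partial>P (u j))"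
    proof (cases "TT = {0..}")
      case True
      have mart: "martingale TT Fl (P (u j)) (X k)" if "k \<in> K" for k
        unfolding Fl_def X_def using that K jN by (intro continuous_time[OF True]) auto
      have int_X: "integrable (P (u j)) (X k s)" if "k \<in> K" "s \<in> TT" for k s
        using mart[OF that(1)] that(2) by (auto simp: martingale_def)
      have "(\<integral>w. (\<Sum>k\<in>K. c k * X k s w) \<partial>P (u j)) = (\<Sum>k\<in>K. c k * (\<integral>w. X k s w \<partial>P (u j)))"
        if "s \<in> TT" for s
        using int_X that by (subst Bochner_Integration.integral_sum) auto
      moreover have "(\<integral>w. X k T w \<partial>P (u j)) = (\<integral>w. X k 0 w \<partial>P (u j))" if "k \<in> K" for k
        using martingale_expectation[OF mart[OF that] prob[OF uj] sub[OF uj] zero times(2) T0] .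
      ultimately show ?thesis
        using zero times(2) by simp
    next
      case False
      then have Nats: "TT = \<nat>" using time_set by simp
      with times(2) obtain n where n: "T = real n" by (auto elim: Nats_cases)
      show ?thesis
        using int unfolding n m_def
        by (intro local_martingale_sum_expectation[where Fl = Fl] finK prob sub uj lm[OF uj, unfolded Nats])
    qed
    also have "\<dots> = (\<integral>w. c j \<partial>P (u j))"
    proof (intro integral_cong_AE borel_measurable_sum borel_measurable_times X_meas uj zero)
      show "AE w in P (u j). (\<Sum>k\<in>K. c k * X k 0 w) = c j"
        using V0[OF uj]
      proof eventually_elim
        case (elim w)
        have "(\<Sum>k\<in>K. c k * X k 0 w) = (\<Sum>k\<in>K. if k = j then c j else 0)"
          using K jN initial elim by (intro sum.cong) (auto simp: X_def)
        then show ?case using finK j by simp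
      qed
    qed simp_all
    finally show ?thesis by (simp add: m_def prob_space)
  qed
  define f where "f v = (\<integral>w. F (\<lambda>j\<in>{..<N'}. V t (w j)) *
    det (mart_matrix Mf N' v T (\<lambda>j. V T (w j))) \<partial>copies P N' v)" for v
  have term_J: "(\<integral>w. F (subtuple J (\<lambda>j. V t (w j))) *
      det (mart_matrix Mf N u T (\<lambda>j. V T (w j))) \<partial>copies P N u) = f (subtuple J u)"
    if J: "J \<subseteq> {..<N}" "card J = N'" for J
  proof -
    let ?e = "\<lambda>i. sorted_list_of_set J ! i"
    let ?Q = "\<lambda>i. P (u i)"
    let ?G = "\<lambda>w. F (subtuple J (\<lambda>j. V t (w j)))"
    let ?D = "\<lambda>I w. set_det I (\<lambda>i k. m k (w i))"
    have finJ: "finite J" using J finite_subset by blast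
    have bij: "bij_betw ?e {..<N'} J"
      using bij_betw_nth_sorted_list_of_set[OF finJ] J(2) by simp
    then have e_J: "?e i \<in> J" if "i < N'" for i
      using that by (auto simp: bij_betw_def)
    then have e_N: "?e i < N" if "i < N'" for i
      using that J(1) by auto
    have det_N: "det (mart_matrix Mf N u T (\<lambda>j. V T (w j))) = ?D {..<N} w" for w
      using det_mat_eq_set_det[of "\<lambda>i. i" N "{..<N}" "\<lambda>i k. m k (w i)"]
      by (simp add: mart_matrix_def m_def X_def bij_betw_def)
    have V_P: "V t \<in> P x \<rightarrow>\<^sub>M restrict_space borel S" if "x \<in> S" for x
      using V[OF times(1)] measurable_cong_sets[OF sets_P[OF that] refl] by blast
    \<comment> \<open>Kept general for two uses: coordinates indexed by \<open>J\<close>, with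
      \<open>g\<close> the increasing enumeration, and coordinates already renumbered, with
      \<open>g\<close> the identity.\<close>
    have tuple_meas: "(\<lambda>w. \<lambda>i\<in>{..<N'}. V t (w (g i))) \<in>
        Pi\<^sub>M I R \<rightarrow>\<^sub>M (\<Pi>\<^sub>M i\<in>{..<N'}. restrict_space borel S)"
      if "\<And>i. i < N' \<Longrightarrow> g i \<in> I" "\<And>i. i < N' \<Longrightarrow> R (g i) = P (u (?e i))"
      for g :: "nat \<Rightarrow> nat" and I R
    proof (rule measurable_restrict)
      fix i assume i: "i \<in> {..<N'}"
      then have "V t \<in> R (g i) \<rightarrow>\<^sub>M restrict_space borel S"
        using that(2) V_P u_S e_N by simp
      with that(1) i show "(\<lambda>w. V t (w (g i))) \<in> Pi\<^sub>M I R \<rightarrow>\<^sub>M restrict_space borel S"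
        by (intro measurable_compose[OF measurable_component_singleton]) auto
    qed
    have G_eq: "?G w = F (\<lambda>i\<in>{..<N'}. V t (w (?e i)))" for w
      by (simp add: subtuple_def J(2))
    \<comment> \<open>The copies outside \<open>J\<close> are integrated out. This is possible
      because \<open>?G\<close> reads only the coordinates in \<open>J\<close>.\<close>
    have "(\<integral>w. ?G w * ?D {..<N} w \<partial>copies P N u) = (\<integral>w. ?G w * ?D J w \<partial>Pi\<^sub>M J ?Q)"
    proof -
      have Un: "J \<union> ({..<N} - J) = {..<N}" using J(1) by auto
      have "(\<integral>w. ?G w * ?D (J \<union> ({..<N} - J)) w \<partial>Pi\<^sub>M (J \<union> ({..<N} - J)) ?Q) =
          (\<integral>w. ?G w * ?D J w \<partial>Pi\<^sub>M J ?Q)"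
      proof (rule integral_set_det_Un; (unfold Un)?)
        show "?G (restrict w J) = ?G w" for w
          unfolding G_eq using e_J by (intro arg_cong[of _ _ F]) (auto simp: restrict_def)
        show "?G \<in> borel_measurable (Pi\<^sub>M J ?Q)"
          unfolding G_eq using e_J by (intro measurable_compose[OF tuple_meas F]) auto
        show "integrable (Pi\<^sub>M {..<N} ?Q) (\<lambda>w. ?G w * ?D {..<N} w)"
          using expectations_exist[OF J] by (simp add: det_N copies_def)
        show "(\<integral>w. (\<Sum>k\<in>K. c k * m k w) \<partial>P (u j)) = c j"
          if "j \<in> K" "K \<subseteq> {..<N}" "integrable (P (u j)) (\<lambda>w. \<Sum>k\<in>K. c k * m k w)" for j K c
          using that by (rule row)
        show "m k \<in> borel_measurable (P (u i))" if "i \<in> {..<N}" for i k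
          unfolding m_def using that by (intro X_meas u_S times(2)) simp
      qed (use finJ prob u_S in auto)
      then show ?thesis by (simp only: Un copies_def)
    qed
    also have "\<dots> = f (subtuple J u)"
    proof -
      \<comment> \<open>Renumbering the coordinates in \<open>J\<close> increasingly turns the
        product law over \<open>J\<close> into the law of \<open>N'\<close> copies started at
        \<open>subtuple J u\<close>.\<close>
      let ?h = "\<lambda>w. \<lambda>n\<in>{..<N'}. w (?e n)"
      let ?I = "\<Pi>\<^sub>M i\<in>{..<N'}. ?Q (?e i)"
      let ?k = "\<lambda>w. F (\<lambda>j\<in>{..<N'}. V t (w j)) *
        det (mart_matrix Mf N' (subtuple J u) T (\<lambda>j. V T (w j)))"
      have copies: "copies P N' (subtuple J u) = ?I"
        unfolding copies_def using J(2) by (intro PiM_cong) (auto simp: subtuple_def)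
      have distr: "distr (Pi\<^sub>M J ?Q) ?I ?h = ?I"
        using bij J(1) e_J prob u_S by (intro distr_PiM_reindex) (auto simp: bij_betw_def)
      have h_meas: "?h \<in> Pi\<^sub>M J ?Q \<rightarrow>\<^sub>M ?I"
        using e_J by (intro measurable_restrict measurable_component_singleton) auto
      have det_N': "det (mart_matrix Mf N' (subtuple J u) T (\<lambda>j. V T (w j))) =
          set_det {..<N'} (\<lambda>i k. m (?e k) (w i))" for w
      proof -
        have "mart_matrix Mf N' (subtuple J u) T (\<lambda>j. V T (w j)) = mat N' N' (\<lambda>(i, k). m (?e k) (w i))"
          using J(2) by (intro eq_matI) (auto simp: mart_matrix_def m_def X_def subtuple_def)
        then show ?thesis
          using det_mat_eq_set_det[of "\<lambda>i. i" N' "{..<N'}" "\<lambda>i k. m (?e k) (w i)"]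
          by (simp add: bij_betw_def)
      qed
      have k_meas: "?k \<in> borel_measurable ?I"
        unfolding det_N'
      proof (intro borel_measurable_times borel_measurable_set_det)
        show "(\<lambda>w. F (\<lambda>j\<in>{..<N'}. V t (w j))) \<in> borel_measurable ?I"
          by (intro measurable_compose[OF tuple_meas F]) auto
        fix i k assume i: "i \<in> {..<N'}"
        have "m (?e k) \<in> borel_measurable (?Q (?e i))"
          unfolding m_def using i by (intro X_meas u_S e_N times(2)) simp
        with i show "(\<lambda>w. m (?e k) (w i)) \<in> borel_measurable ?I"
          by (intro measurable_compose[OF measurable_component_singleton]) auto
      qed simp
      have "?G w * ?D J w = ?k (?h w)" for w
      proof -
        have "?D J w = det (mat N' N' (\<lambda>(i, k). m (?e k) (w (?e i))))"
          using det_mat_eq_set_det[OF bij, of "\<lambda>i k. m k (w i)"] by simp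
        also have "mat N' N' (\<lambda>(i, k). m (?e k) (w (?e i))) =
            mart_matrix Mf N' (subtuple J u) T (\<lambda>j. V T (?h w j))"
          using J(2) by (intro eq_matI) (auto simp: mart_matrix_def m_def X_def subtuple_def)
        finally have "?D J w = det (mart_matrix Mf N' (subtuple J u) T (\<lambda>j. V T (?h w j)))" .
        moreover have "(\<lambda>i\<in>{..<N'}. V t (w (?e i))) = (\<lambda>j\<in>{..<N'}. V t (?h w j))"
          by (auto simp: restrict_def)
        ultimately show ?thesis
          unfolding G_eq by (simp only:)
      qed
      then have "(\<integral>w. ?G w * ?D J w \<partial>Pi\<^sub>M J ?Q) = (\<integral>w. ?k (?h w) \<partial>Pi\<^sub>M J ?Q)"
        by (simp only:)
      also have "\<dots> = integral\<^sup>L ?I ?k"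
        by (subst integral_distr[OF h_meas k_meas, symmetric]) (simp only: distr)
      finally show ?thesis
        unfolding f_def copies .
    qed
    finally show ?thesis by (simp only: det_N)
  qed
  let ?A = "{..<N'} \<rightarrow>\<^sub>E u ` {..<N}"
  have "(LINT v:ordered_tuples S N' | dirac_sum_power N u N'. f v) =
      (\<Sum>v\<in>?A. indicator (ordered_tuples S N') v * f v)"
    unfolding set_lebesgue_integral_def by (simp add: integral_dirac_sum_power[OF inj_u])
  \<comment> \<open>The product measure charges tuples in every order and with repetitions; the
    domain of integration keeps the increasing ones, one for each \<open>J\<close>.\<close>
  also have "\<dots> = (\<Sum>v\<in>ordered_tuples S N' \<inter> ?A. f v)"
    by (intro sum.mono_neutral_cong_right) (auto simp: indicator_def intro!: finite_PiE)
  also have "\<dots> = (\<Sum>J | J \<subseteq> {..<N} \<and> card J = N'. f (subtuple J u))"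
    by (rule sum.reindex_bij_betw[OF bij_betw_subtuple[OF u], symmetric])
  finally show ?thesis
    using term_J by (simp add: f_def)
qed

end
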